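(* Let $\alpha>0$, $p>0$ and $v(r)=\exp(-\alpha r^p)$ for $r\ge 0$. Let $g$ be a polynomial of degree $n$ less than or equal to the integer part of $p$, with $g(0)=0$. (i) If the degree $n$ of $g$ satisfies $n<p$, then $\sigma(V_g,H^\infty_v(\mathbb{C}))=\{0\}$. (ii) If $p=n\in\mathbb{N}$ and $g(z)=\beta z^n+k(z)$, where $k$ is a polynomial of degree strictly less than $n$, then $\sigma(V_g,H^\infty_v(\mathbb{C}))=\{\lambda\in\mathbb{C} : |\lambda|\le |\beta|/\alpha\}$. Moreover, $\sigma(V_g,H^\infty_v(\mathbb{C}))=\{0\}\cup\overline{\{\lambda\in\mathbb{C}\setminus\{0\} : e^{g/\lambda}\notin H^\infty_v(\mathbb{C})\}}$.
   Context: $H(\mathbb{C})$ is the space of entire functions. With $v(z):=v(|z|)$ for $z \in \mathbb{C}$, the weighted Banach space is $H^\infty_v(\mathbb{C})=\{f\in H(\mathbb{C}) : \|f\|_v:=\sup_{z\in\mathbb{C}}v(|z|)|f(z)|<\infty\}$, with norm $\|\cdot\|_v$. The Volterra operator with symbol $g$ is $V_g f(z)=\int_0^z f(\zeta)g'(\zeta)\,d\zeta$, $z\in\mathbb{C}$; under the stated hypotheses it is known to be a continuous operator from $H^\infty_v(\mathbb{C})$ to itself. For a continuous operator $T:X\to X$, the resolvent set $\rho(T,X)$ is the set of $\lambda\in\mathbb{C}$ such that $T-\lambda I:X\to X$ is bijective with continuous inverse, and the spectrum is $\sigma(T,X)=\mathbb{C}\setminus\rho(T,X)$. The bar denotes closure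 in $\mathbb{C}$. *)

theory Defs
  imports "HOL-Complex_Analysis.Complex_Analysis"
begin

definition Hv :: "(real \<Rightarrow> real) \<Rightarrow> (complex \<Rightarrow> complex) set" where
  "Hv v = {f. f holomorphic_on UNIV \<and> bdd_above (range (\<lambda>z. v (norm z) * norm (f z)))}"

definition Hv_norm :: "(real \<Rightarrow> real) \<Rightarrow> (complex \<Rightarrow> complex) \<Rightarrow> real" where
  "Hv_norm v f = (SUP z. v (norm z) * norm (f z))"

text \<open>The value outside the carrier is irrelevant; it is set to \<open>0\<close> because the locale
  \<^locale>\<open>Metric_space\<close> requires nonnegativity of the distance on the whole type, where
  the supremum of an unbounded set would be unspecified.\<close>

definition Hv_dist :: "(real \<Rightarrow> real) \<Rightarrow> (complex \<Rightarrow> complex) \<Rightarrow> (complex \<Rightarrow> complex) \<Rightarrow> real" where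
  "Hv_dist v f h = (if f \<in> Hv v \<and> h \<in> Hv v then Hv_norm v (\<lambda>z. f z - h z) else 0)"

definition Hv_top :: "(real \<Rightarrow> real) \<Rightarrow> (complex \<Rightarrow> complex) topology" where
  "Hv_top v = Metric_space.mtopology (Hv v) (Hv_dist v)"

lemma Hv_diff:
  assumes v: "\<And>r. r \<ge> 0 \<Longrightarrow> v r > 0" and f: "f \<in> Hv v" and h: "h \<in> Hv v"
  shows "(\<lambda>z. f z - h z) \<in> Hv v"
proof -
  from f h obtain A B where
    A: "\<And>z. v (norm z) * norm (f z) \<le> A" and B: "\<And>z. v (norm z) * norm (h z) \<le> B"
    unfolding Hv_def bdd_above_def by blast
  have "v (norm z) * norm (f z - h z) \<le> A + B" for z
  proof -
    have "v (norm z) * norm (f z - h z) \<le> v (norm z) * (norm (f z) + norm (h z))"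
      using v[of "norm z"] norm_triangle_ineq4 by (intro mult_left_mono) auto
    also have "\<dots> \<le> A + B" using A[of z] B[of z] by (simp add: algebra_simps)
    finally show ?thesis .
  qed
  then have "bdd_above (range (\<lambda>z. v (norm z) * norm (f z - h z)))"
    by (auto intro!: bdd_aboveI)
  with f h show ?thesis by (auto simp: Hv_def intro!: holomorphic_intros)
qed

lemma Hv_norm_upper:
  assumes "f \<in> Hv v"
  shows "v (norm z) * norm (f z) \<le> Hv_norm v f"
  using assms unfolding Hv_norm_def Hv_def by (auto intro!: cSUP_upper)

lemma Metric_space_Hv:
  assumes v: "\<And>r. r \<ge> 0 \<Longrightarrow> v r > 0"
  shows "Metric_space (Hv v) (Hv_dist v)"
proof
  show "0 \<le> Hv_dist v f h" for f h
  proof (cases "f \<in> Hv v \<and> h \<in> Hv v")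
    case True
    then have "v (norm (0::complex)) * norm (f 0 - h 0) \<le> Hv_norm v (\<lambda>z. f z - h z)"
      by (intro Hv_norm_upper Hv_diff v) auto
    moreover have "0 \<le> v (norm (0::complex)) * norm (f 0 - h 0)"
      using v[of 0] by simp
    ultimately show ?thesis using True by (simp add: Hv_dist_def)
  qed (auto simp: Hv_dist_def)
  show "Hv_dist v f h = Hv_dist v h f" for f h
    by (auto simp: Hv_dist_def Hv_norm_def norm_minus_commute)
  show "(Hv_dist v f h = 0) = (f = h)" if f: "f \<in> Hv v" and h: "h \<in> Hv v" for f h
  proof
    assume 0: "Hv_dist v f h = 0"
    show "f = h"
    proof
      fix z
      have "v (norm z) * norm (f z - h z) \<le> 0"
        using Hv_norm_upper[OF Hv_diff[OF v f h], of z] 0 f h by (simp add: Hv_dist_def)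
      then show "f z = h z" using v[of "norm z"] by (simp add: mult_le_0_iff)
    qed
  qed (use f h in \<open>simp add: Hv_dist_def Hv_norm_def\<close>)
  show "Hv_dist v f k \<le> Hv_dist v f h + Hv_dist v h k"
    if f: "f \<in> Hv v" and h: "h \<in> Hv v" and k: "k \<in> Hv v" for f h k
  proof -
    have "v (norm z) * norm (f z - k z) \<le> Hv_dist v f h + Hv_dist v h k" for z
    proof -
      have "norm (f z - k z) \<le> norm (f z - h z) + norm (h z - k z)"
        using norm_triangle_ineq[of "f z - h z" "h z - k z"] by simp
      then have "v (norm z) * norm (f z - k z)
          \<le> v (norm z) * norm (f z - h z) + v (norm z) * norm (h z - k z)"
        using v[of "norm z"] by (simp flip: distrib_left)
      then show ?thesis
        using Hv_norm_upper[OF Hv_diff[OF v f h], of z] Hv_norm_upper[OF Hv_diff[OF v h k], of z]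
          f h k by (simp add: Hv_dist_def)
    qed
    then have "Hv_norm v (\<lambda>z. f z - k z) \<le> Hv_dist v f h + Hv_dist v h k"
      unfolding Hv_norm_def by (intro cSUP_least) auto
    then show ?thesis using f k by (simp add: Hv_dist_def)
  qed
qed

lemma topspace_Hv_top:
  assumes "\<And>r. r \<ge> 0 \<Longrightarrow> v r > 0"
  shows "topspace (Hv_top v) = Hv v"
  unfolding Hv_top_def
  by (rule Metric_space.topspace_mtopology[OF Metric_space_Hv[OF assms]])

definition volterra :: "(complex \<Rightarrow> complex) \<Rightarrow> (complex \<Rightarrow> complex) \<Rightarrow> complex \<Rightarrow> complex" where
  "volterra g f z = contour_integral (linepath 0 z) (\<lambda>\<zeta>. f \<zeta> * deriv g \<zeta>)"

text \<open>The underlying function space of the topology \<open>X\<close> is its \<^const>\<open>topspace\<close>.\<close>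

definition resolvent_set ::
    "(complex \<Rightarrow> complex) topology \<Rightarrow> ((complex \<Rightarrow> complex) \<Rightarrow> complex \<Rightarrow> complex) \<Rightarrow> complex set" where
  "resolvent_set X T = {l.
     bij_betw (\<lambda>f z. T f z - l * f z) (topspace X) (topspace X) \<and>
     continuous_map X X (inv_into (topspace X) (\<lambda>f z. T f z - l * f z))}"

definition spectrum ::
    "(complex \<Rightarrow> complex) topology \<Rightarrow> ((complex \<Rightarrow> complex) \<Rightarrow> complex \<Rightarrow> complex) \<Rightarrow> complex set" where
  "spectrum X T = UNIV - resolvent_set X T"

end

theory Submission imports Defs begin

text \<open>For \<open>l \<noteq> 0\<close> the equation \<open>V\<^sub>g f - l f = h\<close> is a linear first order differential equation with
a prescribed value at \<open>0\<close>, so it has exactly one entire solution for each entire \<open>h\<close>. Variation of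
constants and an integration by parts give
\<open>f = - h / l - W h / l\<^sup>2\<close> with \<open>W h (z) = e\<^sup>\<mu>\<^sup>g\<^sup>(\<^sup>z\<^sup>) \<integral> e\<^sup>-\<^sup>\<mu>\<^sup>g g' h\<close>, integrated from \<open>0\<close> to \<open>z\<close>, and
\<open>\<mu> = 1 / l\<close>. Hence \<open>l\<close> is in the resolvent set as soon as \<open>W\<close> and \<open>V\<^sub>g\<close> are bounded on the weighted
space; the latter is the case \<open>\<mu> = 0\<close> of the former.

Let \<open>G\<close> be the polynomial whose coefficients are the moduli of those of \<open>g\<close>. Along a ray
\<open>G'\<close> dominates \<open>\<bar>g'\<bar>\<close>, and hence the increments of \<open>G\<close> dominate those of \<open>g\<close>. Suppose that for some
\<open>\<kappa> > \<bar>\<mu>\<bar>\<close> the increments of \<open>\<kappa> G\<close> exceed those of \<open>\<alpha> r\<^sup>p\<close> by at most a constant \<open>K\<close>. Then, with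
\<open>c = \<kappa> - \<bar>\<mu>\<bar>\<close>, the weighted integrand of \<open>W h\<close> at distance \<open>t\<close> on the ray to distance \<open>r\<close> is at most
\<open>\<parallel>h\<parallel> e\<^sup>K G'(t) exp (- c (G(r) - G(t)))\<close>, which has an explicit primitive bounded by
\<open>\<parallel>h\<parallel> e\<^sup>K / c\<close> (lemma \<open>weighted_volterra_bounded\<close>). Such a \<open>\<kappa>\<close> exists for every \<open>\<mu>\<close> when the
degree of \<open>g\<close> is below \<open>p\<close>, and exactly for \<open>\<bar>\<mu>\<bar> \<bar>\<beta>\<bar> < \<alpha>\<close>, that is \<open>\<bar>l\<bar> > \<bar>\<beta>\<bar> / \<alpha>\<close>, when \<open>g\<close> has
degree \<open>p\<close> and leading coefficient \<open>\<beta>\<close> (lemma \<open>subordinateI\<close> gives the existence).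

The spectral points are all found by failure of surjectivity. For \<open>l = 0\<close>, every \<open>V\<^sub>g f\<close> vanishes at
\<open>0\<close>. For \<open>0 < \<bar>l\<bar> < \<bar>\<beta>\<bar> / \<alpha>\<close>, the only solution of \<open>V\<^sub>g f - l f = - l\<close> is \<open>e\<^sup>g\<^sup>/\<^sup>l\<close>, which outgrows the
reciprocal of the weight along a ray on which \<open>\<beta> z\<^sup>n / l\<close> is positive. On the critical circle \<open>\<bar>l\<bar> = \<bar>\<beta>\<bar> / \<alpha>\<close> the function
\<open>e\<^sup>g\<^sup>/\<^sup>l\<close> may well belong to the space, depending on the lower order terms of \<open>g\<close>. There the
right-hand side \<open>h = exp (\<beta> z\<^sup>n / l)\<close> is taken, whose modulus is the reciprocal of the weight on such a
ray; the quotient of a solution in the space by \<open>h\<close> would be bounded on the ray, and its differential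
equation would then bound \<open>\<alpha> r\<^sup>n\<close> by a polynomial of lower degree (lemma
\<open>boundary_in_spectrum\<close>). This works at each boundary point separately and so replaces the
closedness of the spectrum.\<close>

section \<open>Growth of a polynomial compared with a power\<close>

definition majorant :: "complex poly \<Rightarrow> real poly" where
  "majorant g = map_poly norm g"

lemma coeff_majorant [simp]: "coeff (majorant g) i = norm (coeff g i)"
  by (simp add: majorant_def coeff_map_poly)

lemma degree_majorant [simp]: "degree (majorant g) = degree g"
  by (simp add: majorant_def degree_map_poly)

lemma pderiv_majorant: "pderiv (majorant g) = majorant (pderiv g)"
  by (simp add: poly_eq_iff coeff_pderiv norm_mult flip: of_nat_Suc)

lemma norm_poly_le_majorant:
  assumes "norm z \<le> r" shows "norm (poly g z) \<le> poly (majorant g) r"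
proof -
  have "norm (poly g z) \<le> (\<Sum>i\<le>degree g. norm (coeff g i) * norm z ^ i)"
    unfolding poly_altdef by (rule sum_norm_le) (simp add: norm_mult norm_power)
  also have "\<dots> \<le> (\<Sum>i\<le>degree g. norm (coeff g i) * r ^ i)"
    using assms by (intro sum_mono mult_left_mono power_mono) auto
  finally show ?thesis by (simp add: poly_altdef)
qed

lemma majorant_nonneg: "0 \<le> r \<Longrightarrow> 0 \<le> poly (majorant g) r"
  by (auto simp: poly_altdef intro!: sum_nonneg)

lemma majorant_mono: "0 \<le> s \<Longrightarrow> s \<le> r \<Longrightarrow> poly (majorant g) s \<le> poly (majorant g) r"
  by (auto simp: poly_altdef intro!: sum_mono mult_left_mono power_mono)

text \<open>No exponent of the majorant exceeds \<open>p\<close>, so its quotient by \<open>r\<^sup>p\<close> is nonincreasing. The inequality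
is written without division to include \<open>s = 0\<close>.\<close>

lemma majorant_cross_le:
  assumes "real (degree g) \<le> p" "0 \<le> s" "s \<le> r"
  shows "poly (majorant g) r * s powr p \<le> poly (majorant g) s * r powr p"
proof (cases "s = 0")
  case True
  then show ?thesis using majorant_nonneg[of 0 g] by simp
next
  case False
  with assms have s: "0 < s" "0 < r" by auto
  have "norm (coeff g i) * r ^ i * s powr p \<le> norm (coeff g i) * s ^ i * r powr p"
    if "i \<le> degree g" for i
  proof -
    have "real i \<le> p" using that assms(1) by linarith
    then have "s powr (p - i) \<le> r powr (p - i)" using s assms by (intro powr_mono2) auto
    then have "(r ^ i * s ^ i) * s powr (p - i) \<le> (r ^ i * s ^ i) * r powr (p - i)"
      using s by (intro mult_left_mono) auto
    moreover have "x powr p = x ^ i * x powr (p - i)" if "0 < x" for x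
      using that by (simp add: powr_diff powr_realpow)
    ultimately have "r ^ i * s powr p \<le> s ^ i * r powr p"
      using s by (simp add: mult_ac)
    then show ?thesis by (metis mult.assoc mult_left_mono norm_ge_zero)
  qed
  then show ?thesis by (auto simp: poly_altdef sum_distrib_right intro!: sum_mono)
qed

text \<open>Increments are compared, and not values, because the integrand of the Volterra operator at an
intermediate point of the ray contains the growth between that point and the end point.\<close>

definition subordinate :: "real \<Rightarrow> complex poly \<Rightarrow> real \<Rightarrow> real \<Rightarrow> bool" where
  "subordinate \<kappa> g \<alpha> p \<longleftrightarrow> (\<exists>K. \<forall>s r. 0 \<le> s \<longrightarrow> s \<le> r \<longrightarrow>
     \<kappa> * (poly (majorant g) r - poly (majorant g) s) \<le> K + \<alpha> * (r powr p - s powr p))"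

lemma subordinateE:
  assumes "subordinate \<kappa> g \<alpha> p"
  obtains K where "\<And>s r. 0 \<le> s \<Longrightarrow> s \<le> r \<Longrightarrow>
    \<kappa> * (poly (majorant g) r - poly (majorant g) s) \<le> K + \<alpha> * (r powr p - s powr p)"
  using assms unfolding subordinate_def by auto

lemma subordinate_mono:
  assumes "subordinate \<kappa> g \<alpha> p" "\<mu> \<le> \<kappa>"
  shows "subordinate \<mu> g \<alpha> p"
proof -
  obtain K where K: "\<And>s r. 0 \<le> s \<Longrightarrow> s \<le> r \<Longrightarrow>
      \<kappa> * (poly (majorant g) r - poly (majorant g) s) \<le> K + \<alpha> * (r powr p - s powr p)"
    using subordinateE[OF assms(1)] by blast
  have "\<mu> * (poly (majorant g) r - poly (majorant g) s) \<le> K + \<alpha> * (r powr p - s powr p)"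
    if "0 \<le> s" "s \<le> r" for s r
    using K[OF that] mult_right_mono[OF assms(2), of "poly (majorant g) r - poly (majorant g) s"]
      majorant_mono[OF that, of g] by linarith
  then show ?thesis unfolding subordinate_def by blast
qed

lemma majorant_over_powr_tendsto:
  assumes "real (degree g) \<le> p"
  shows "((\<lambda>r. poly (majorant g) r * r powr (-p)) \<longlongrightarrow>
    (if real (degree g) = p then norm (lead_coeff g) else 0)) at_top"
proof -
  have monomial: "((\<lambda>r. norm (coeff g i) * r ^ i * r powr (-p)) \<longlongrightarrow>
      (if real i = p then norm (coeff g i) else 0)) at_top" if "i \<le> degree g" for i
  proof -
    have ev: "\<forall>\<^sub>F r::real in at_top. norm (coeff g i) * r powr (real i - p) = norm (coeff g i) * r ^ i * r powr (-p)"
      using eventually_gt_at_top[of 0]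
      by eventually_elim (simp add: powr_realpow powr_diff powr_minus divide_inverse)
    have "((\<lambda>r. norm (coeff g i) * r powr (real i - p)) \<longlongrightarrow> (if real i = p then norm (coeff g i) else 0)) at_top"
    proof (cases "real i = p")
      case True
      have "\<forall>\<^sub>F r::real in at_top. norm (coeff g i) = norm (coeff g i) * r powr (real i - p)"
        using eventually_gt_at_top[of 0] by eventually_elim (simp add: True)
      with True show ?thesis by (simp add: tendsto_eventually eventually_mono)
    next
      case False
      with that assms have "real i - p < 0" by linarith
      then have "((\<lambda>r::real. r powr (real i - p)) \<longlongrightarrow> 0) at_top"
        by (intro tendsto_neg_powr filterlim_ident)
      from tendsto_mult_right_zero[OF this, of "norm (coeff g i)"] False show ?thesis by simp
    qed
    then show ?thesis using ev by (rule Lim_transform_eventually)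
  qed
  have "((\<lambda>r. \<Sum>i\<le>degree g. norm (coeff g i) * r ^ i * r powr (-p)) \<longlongrightarrow>
      (\<Sum>i\<le>degree g. if real i = p then norm (coeff g i) else 0)) at_top"
    by (intro tendsto_sum monomial) auto
  moreover have "(\<Sum>i\<le>degree g. if real i = p then norm (coeff g i) else 0) =
      (if real (degree g) = p then norm (lead_coeff g) else 0)"
  proof (cases "real (degree g) = p")
    case True
    then show ?thesis by (simp flip: True)
  next
    case False
    then show ?thesis using assms by (auto intro!: sum.neutral)
  qed
  ultimately show ?thesis by (simp add: poly_altdef sum_distrib_right)
qed

text \<open>Beyond some radius \<open>\<kappa> G(r) \<le> \<alpha> r\<^sup>p\<close>, and since \<open>G(t) / t\<^sup>p\<close> is nonincreasing this inequality
of values passes to increments: \<open>G(r) - G(s) \<le> G(r) / r\<^sup>p * (r\<^sup>p - s\<^sup>p)\<close>. Smaller radii only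
contribute to the constant.\<close>

lemma subordinateI:
  assumes p: "real (degree g) \<le> p" and "0 < p" and "0 < \<alpha>" and \<kappa>: "0 \<le> \<kappa>"
    and lead: "real (degree g) = p \<Longrightarrow> \<kappa> * norm (lead_coeff g) < \<alpha>"
  shows "subordinate \<kappa> g \<alpha> p"
proof -
  let ?G = "poly (majorant g)"
  have "((\<lambda>r. \<kappa> * (?G r * r powr (-p))) \<longlongrightarrow>
     \<kappa> * (if real (degree g) = p then norm (lead_coeff g) else 0)) at_top"
    by (intro tendsto_mult_left majorant_over_powr_tendsto p)
  moreover have "\<kappa> * (if real (degree g) = p then norm (lead_coeff g) else 0) < \<alpha>"
    using lead \<open>0 < \<alpha>\<close> by simp
  ultimately have "\<forall>\<^sub>F r in at_top. \<kappa> * (?G r * r powr (-p)) < \<alpha>"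
    by (rule order_tendstoD(2))
  then obtain R0 where R0: "\<And>r. r \<ge> R0 \<Longrightarrow> \<kappa> * (?G r * r powr (-p)) < \<alpha>"
    by (auto simp: eventually_at_top_linorder)
  define R where "R = max R0 1"
  have "\<kappa> * (?G r - ?G s) \<le> \<kappa> * ?G R + \<alpha> * (r powr p - s powr p)" if "0 \<le> s" "s \<le> r" for s r
  proof -
    have pw: "s powr p \<le> r powr p" using that \<open>0 < p\<close> by (intro powr_mono2) auto
    have GR: "0 \<le> \<kappa> * ?G R" using \<kappa> by (auto simp: R_def intro!: mult_nonneg_nonneg majorant_nonneg)
    show ?thesis
    proof (cases "r \<le> R")
      case True
      have "?G r - ?G s \<le> ?G R"
        using majorant_mono[of r R g] majorant_nonneg[of s g] that True by simp
      then have "\<kappa> * (?G r - ?G s) \<le> \<kappa> * ?G R" using \<kappa> by (rule mult_left_mono)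
      then show ?thesis using pw \<open>0 < \<alpha>\<close> by (simp add: add_increasing2)
    next
      case False
      then have r: "0 < r" "R0 \<le> r" by (auto simp: R_def)
      then have rp: "r powr p > 0" by simp
      have "\<kappa> * ?G r \<le> \<alpha> * r powr p"
        using R0[OF r(2)] rp by (simp add: powr_minus field_simps)
      then have "(\<kappa> * ?G r) * (r powr p - s powr p) \<le> (\<alpha> * r powr p) * (r powr p - s powr p)"
        using pw by (intro mult_right_mono) auto
      moreover have "\<kappa> * (?G r * s powr p) \<le> \<kappa> * (?G s * r powr p)"
        using \<kappa> p that by (intro mult_left_mono majorant_cross_le)
      ultimately have "(\<kappa> * (?G r - ?G s)) * r powr p \<le> (\<alpha> * (r powr p - s powr p)) * r powr p"
        by (simp add: algebra_simps)
      with rp have "\<kappa> * (?G r - ?G s) \<le> \<alpha> * (r powr p - s powr p)" by (simp only: mult_le_cancel_right_pos)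
      with GR show ?thesis by linarith
    qed
  qed
  then show ?thesis unfolding subordinate_def by blast
qed

lemma power_not_le_smaller_degree:
  assumes "degree k < n" and \<delta>: "0 < \<delta>"
  shows "\<exists>r\<ge>0. C + poly (majorant k) r < \<delta> * r ^ n"
proof (rule ccontr)
  assume "\<not> ?thesis"
  then have le: "\<delta> * r ^ n \<le> C + poly (majorant k) r" if "r \<ge> 0" for r
    using that by force
  have sub: "subordinate 1 k (\<delta>/2) (real n)"
    using assms by (intro subordinateI) auto
  then obtain K where K: "\<And>s r. 0 \<le> s \<Longrightarrow> s \<le> r \<Longrightarrow>
      poly (majorant k) r - poly (majorant k) s \<le> K + \<delta>/2 * (r powr real n - s powr real n)"
    using subordinateE[OF sub] by (metis mult_1)
  define B where "B = C + poly (majorant k) 0 + K"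
  define r where "r = max 1 (2 * (\<bar>B\<bar> + 1) / \<delta>)"
  have r: "1 \<le> r" "2 * (\<bar>B\<bar> + 1) / \<delta> \<le> r" by (auto simp: r_def)
  have "\<delta>/2 * r ^ n \<le> B"
    using le[of r] K[of 0 r] r(1) assms(1) by (simp add: B_def powr_realpow field_simps)
  moreover have "r \<le> r ^ n" using r(1) assms(1) by (simp add: self_le_power)
  ultimately have "\<delta>/2 * r \<le> B" using \<delta> by (smt (verit) mult_left_mono half_gt_zero)
  with r(2) \<delta> show False by (simp add: field_simps)
qed

section \<open>Estimates along rays\<close>

text \<open>The complex increment is bounded through a real primitive \<open>\<phi>\<close> of the bound on the derivative, which
avoids all integrals.\<close>

lemma norm_diff_along_ray_le:
  fixes F F' :: "complex \<Rightarrow> complex" and \<phi> \<phi>' :: "real \<Rightarrow> real"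
  assumes F: "\<And>z. (F has_field_derivative F' z) (at z)"
    and \<phi>: "\<And>t. (\<phi> has_field_derivative \<phi>' t) (at t)"
    and e: "norm e \<le> 1" and sr: "s \<le> r"
    and le: "\<And>t. s \<le> t \<Longrightarrow> t \<le> r \<Longrightarrow> norm (F' (of_real t * e)) \<le> \<phi>' t"
  shows "norm (F (of_real r * e) - F (of_real s * e)) \<le> \<phi> r - \<phi> s"
proof (cases "s = r")
  case False
  with sr have "s < r" by simp
  have d: "((\<lambda>t. F (of_real t * e)) has_vector_derivative e * F' (of_real t * e)) (at t)" for t
  proof -
    have "((\<lambda>t. of_real t * e) has_vector_derivative e) (at t)"
      by (auto intro!: derivative_eq_intros)
    from field_vector_diff_chain_at[OF this F] show ?thesis by (simp add: o_def)
  qed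
  show ?thesis
  proof (rule differentiable_bound_general[OF \<open>s < r\<close>])
    show "continuous_on {s..r} (\<lambda>t. F (of_real t * e))"
      by (intro continuous_at_imp_continuous_on ballI) (use d has_vector_derivative_continuous in blast)
    show "continuous_on {s..r} \<phi>"
      by (intro continuous_at_imp_continuous_on ballI) (use \<phi> DERIV_isCont in blast)
    show "((\<lambda>t. F (of_real t * e)) has_vector_derivative e * F' (of_real t * e)) (at t)" for t by (rule d)
    show "(\<phi> has_vector_derivative \<phi>' t) (at t)" for t
      using \<phi> by (simp add: has_real_derivative_iff_has_vector_derivative)
    show "norm (e * F' (of_real t * e)) \<le> \<phi>' t" if "s < t" "t < r" for t
      using mult_mono[OF e le[of t]] that by (simp add: norm_mult)
  qed
qed simp

lemma poly_diff_along_ray_le: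
  assumes "norm e \<le> 1" "0 \<le> s" "s \<le> r"
  shows "norm (poly g (of_real r * e) - poly g (of_real s * e)) \<le> poly (majorant g) r - poly (majorant g) s"
  by (rule norm_diff_along_ray_le[where F' = "poly (pderiv g)" and \<phi>' = "poly (pderiv (majorant g))"])
    (use assms in \<open>auto simp: norm_mult mult_left_le simp flip: pderiv_majorant intro!: norm_poly_le_majorant[of _ _ "pderiv g", folded pderiv_majorant]\<close>)

section \<open>The Volterra operator and its resolvent on entire functions\<close>

lemma volterra_eq_primitive:
  assumes "\<And>z. (F has_field_derivative f z * deriv g z) (at z)"
  shows "volterra g f z = F z - F 0"
  using contour_integral_primitive[of UNIV F "\<lambda>z. f z * deriv g z" "linepath 0 z"] assms
  unfolding volterra_def by (simp add: contour_integral_unique)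

lemma volterra_0 [simp]: "volterra g f 0 = 0"
  by (simp add: volterra_def contour_integral_trivial)

lemma volterra_has_field_derivative:
  assumes "f holomorphic_on UNIV"
  shows "(volterra (poly g) f has_field_derivative f z * poly (pderiv g) z) (at z)"
proof -
  have dg: "deriv (poly g) = poly (pderiv g)" by (intro ext DERIV_imp_deriv poly_DERIV)
  have "(\<lambda>z. f z * poly (pderiv g) z) holomorphic_on UNIV"
    using assms by (intro holomorphic_intros)
  then obtain F where F: "\<And>z. (F has_field_derivative f z * poly (pderiv g) z) (at z)"
    using holomorphic_convex_primitive'[of UNIV "\<lambda>z. f z * poly (pderiv g) z"] by auto
  then have "volterra (poly g) f = (\<lambda>z. F z - F 0)"
    by (intro ext volterra_eq_primitive) (simp add: dg)
  with F show ?thesis by (auto intro!: derivative_eq_intros)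
qed

lemma volterra_eqI:
  assumes "\<And>z. (F has_field_derivative f z * poly (pderiv g) z) (at z)" "F 0 = 0"
  shows "volterra (poly g) f = F"
proof
  have "deriv (poly g) = poly (pderiv g)" by (intro ext DERIV_imp_deriv poly_DERIV)
  then show "volterra (poly g) f z = F z" for z
    using volterra_eq_primitive[of F f "poly g" z] assms by simp
qed

lemma volterra_holomorphic:
  assumes "f holomorphic_on UNIV"
  shows "volterra (poly g) f holomorphic_on UNIV"
  using volterra_has_field_derivative[OF assms] holomorphic_on_open open_UNIV by blast

text \<open>This is the operator \<open>W\<close> that carries the resolvent at \<open>1 / \<mu>\<close>; it solves
\<open>W' = (\<mu> W + h) g'\<close>, \<open>W(0) = 0\<close>. The Volterra operator itself is the case \<open>\<mu> = 0\<close>, so that one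
estimate covers both.\<close>

definition weighted_volterra :: "complex poly \<Rightarrow> complex \<Rightarrow> (complex \<Rightarrow> complex) \<Rightarrow> complex \<Rightarrow> complex" where
  "weighted_volterra g \<mu> h z =
     exp (\<mu> * poly g z) * volterra (poly g) (\<lambda>\<zeta>. exp (- \<mu> * poly g \<zeta>) * h \<zeta>) z"

definition resolvent_op :: "complex poly \<Rightarrow> complex \<Rightarrow> (complex \<Rightarrow> complex) \<Rightarrow> complex \<Rightarrow> complex" where
  "resolvent_op g l h z = - h z / l - weighted_volterra g (1 / l) h z / l\<^sup>2"

lemma weighted_volterra_holomorphic:
  assumes "h holomorphic_on UNIV"
  shows "weighted_volterra g \<mu> h holomorphic_on UNIV"
  unfolding weighted_volterra_def
  by (intro holomorphic_intros volterra_holomorphic assms)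

lemma weighted_volterra_0 [simp]: "weighted_volterra g \<mu> h 0 = 0"
  by (simp add: weighted_volterra_def)

lemma volterra_eq_weighted: "volterra (poly g) f = weighted_volterra g 0 f"
  by (simp add: weighted_volterra_def fun_eq_iff)

lemma weighted_volterra_has_field_derivative:
  assumes "h holomorphic_on UNIV"
  shows "(weighted_volterra g \<mu> h has_field_derivative
    (\<mu> * weighted_volterra g \<mu> h z + h z) * poly (pderiv g) z) (at z)"
proof -
  have "(\<lambda>\<zeta>. exp (- \<mu> * poly g \<zeta>) * h \<zeta>) holomorphic_on UNIV"
    using assms by (intro holomorphic_intros)
  from volterra_has_field_derivative[OF this] 
  show ?thesis unfolding weighted_volterra_def
    by (auto intro!: derivative_eq_intros simp: algebra_simps exp_minus)
qed

text \<open>Uniqueness for the initial value problem: \<open>e\<^sup>-\<^sup>\<mu>\<^sup>g W\<close> is a primitive of \<open>e\<^sup>-\<^sup>\<mu>\<^sup>g h g'\<close>.\<close>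

lemma weighted_volterra_eqI:
  assumes W: "\<And>z. (W has_field_derivative (\<mu> * W z + h z) * poly (pderiv g) z) (at z)"
    and "W 0 = 0"
  shows "weighted_volterra g \<mu> h = W"
proof -
  have "volterra (poly g) (\<lambda>\<zeta>. exp (- \<mu> * poly g \<zeta>) * h \<zeta>) = (\<lambda>z. exp (- \<mu> * poly g z) * W z)"
    by (rule volterra_eqI) (use assms in \<open>auto intro!: derivative_eq_intros simp: algebra_simps\<close>)
  then show ?thesis
    by (simp add: weighted_volterra_def fun_eq_iff exp_minus)
qed

lemma weighted_volterra_diff:
  assumes "f holomorphic_on UNIV" "h holomorphic_on UNIV"
  shows "weighted_volterra g \<mu> (\<lambda>z. f z - h z) =
    (\<lambda>z. weighted_volterra g \<mu> f z - weighted_volterra g \<mu> h z)"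
  by (rule weighted_volterra_eqI)
    (auto intro!: derivative_eq_intros weighted_volterra_has_field_derivative assms simp: algebra_simps)

text \<open>By the differential equation for \<open>W\<close>, the function \<open>- W / l\<close> is a primitive of \<open>g'\<close> times the
resolvent formula.\<close>

lemma volterra_resolvent_op:
  assumes h: "h holomorphic_on UNIV" and l: "l \<noteq> 0"
  shows "volterra (poly g) (resolvent_op g l h) z - l * resolvent_op g l h z = h z"
proof -
  have "volterra (poly g) (resolvent_op g l h) = (\<lambda>z. - weighted_volterra g (1 / l) h z / l)"
    by (rule volterra_eqI)
      (use l in \<open>auto intro!: derivative_eq_intros weighted_volterra_has_field_derivative[OF h]
         simp: resolvent_op_def field_simps power2_eq_square\<close>)
  then show ?thesis using l by (simp add: resolvent_op_def field_simps power2_eq_square)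
qed

text \<open>For \<open>h = V\<^sub>g f - l f\<close> the function \<open>- l V\<^sub>g f\<close> solves the initial value problem that characterises
\<open>W h\<close>.\<close>

lemma resolvent_op_volterra:
  assumes f: "f holomorphic_on UNIV" and l: "l \<noteq> 0"
  shows "resolvent_op g l (\<lambda>z. volterra (poly g) f z - l * f z) = f"
proof -
  have "weighted_volterra g (1 / l) (\<lambda>z. volterra (poly g) f z - l * f z) =
      (\<lambda>z. - l * volterra (poly g) f z)"
    by (rule weighted_volterra_eqI)
      (use l in \<open>auto intro!: derivative_eq_intros volterra_has_field_derivative[OF f]
         simp: field_simps\<close>)
  then show ?thesis using l by (simp add: resolvent_op_def fun_eq_iff field_simps power2_eq_square)
qed


section \<open>Bounded operators on the weighted space\<close>

lemma Hv_normI: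
  assumes "f holomorphic_on UNIV" "\<And>z. v (norm z) * norm (f z) \<le> B"
  shows "f \<in> Hv v" "Hv_norm v f \<le> B"
proof -
  show "f \<in> Hv v" using assms by (auto simp: Hv_def intro!: bdd_aboveI)
  show "Hv_norm v f \<le> B" unfolding Hv_norm_def using assms(2) by (intro cSUP_least) auto
qed

lemma continuous_map_Hv_top:
  assumes v: "\<And>r. r \<ge> 0 \<Longrightarrow> v r > 0"
    and T: "\<And>f. f \<in> Hv v \<Longrightarrow> T f \<in> Hv v"
    and diff: "\<And>f h. f \<in> Hv v \<Longrightarrow> h \<in> Hv v \<Longrightarrow> T (\<lambda>z. f z - h z) = (\<lambda>z. T f z - T h z)"
    and B: "\<And>f. f \<in> Hv v \<Longrightarrow> Hv_norm v (T f) \<le> B * Hv_norm v f"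
  shows "continuous_map (Hv_top v) (Hv_top v) T"
proof -
  interpret Metric_space "Hv v" "Hv_dist v" by (rule Metric_space_Hv) (rule v)
  have lip: "Hv_dist v (T f) (T h) \<le> (\<bar>B\<bar> + 1) * Hv_dist v f h" if "f \<in> Hv v" "h \<in> Hv v" for f h
  proof -
    have "Hv_dist v (T f) (T h) \<le> B * Hv_dist v f h"
      using that B[OF Hv_diff[OF v that]] T by (simp add: Hv_dist_def diff)
    also have "\<dots> \<le> (\<bar>B\<bar> + 1) * Hv_dist v f h"
      by (intro mult_right_mono nonneg) auto
    finally show ?thesis .
  qed
  have "continuous_map mtopology mtopology T"
    unfolding metric_continuous_map[OF Metric_space_axioms]
  proof (intro conjI ballI allI impI)
    show "T ` Hv v \<subseteq> Hv v" using T by auto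
    fix f and \<epsilon> :: real assume f: "f \<in> Hv v" and "\<epsilon> > 0"
    show "\<exists>\<delta>>0. \<forall>h. h \<in> Hv v \<and> Hv_dist v f h < \<delta> \<longrightarrow> Hv_dist v (T f) (T h) < \<epsilon>"
    proof (intro exI[of _ "\<epsilon> / (\<bar>B\<bar> + 1)"] conjI allI impI)
      show "0 < \<epsilon> / (\<bar>B\<bar> + 1)" using \<open>\<epsilon> > 0\<close> by (intro divide_pos_pos) auto
      fix h assume h: "h \<in> Hv v \<and> Hv_dist v f h < \<epsilon> / (\<bar>B\<bar> + 1)"
      then have "(\<bar>B\<bar> + 1) * Hv_dist v f h < \<epsilon>"
        by (simp add: pos_less_divide_eq mult.commute add_nonneg_pos)
      with lip[OF f, of h] h show "Hv_dist v (T f) (T h) < \<epsilon>" by linarith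
    qed
  qed
  then show ?thesis by (simp add: Hv_top_def)
qed

locale exp_weight =
  fixes \<alpha> p :: real and v :: "real \<Rightarrow> real"
  assumes \<alpha>: "\<alpha> > 0" and p: "p > 0"
    and v: "\<And>r. r \<ge> 0 \<Longrightarrow> v r = exp (- \<alpha> * r powr p)"
begin

lemma v_pos: "r \<ge> 0 \<Longrightarrow> v r > 0" by (simp add: v)

lemma v_le_1: "r \<ge> 0 \<Longrightarrow> v r \<le> 1" using \<alpha> by (simp add: v)

lemma topspace [simp]: "topspace (Hv_top v) = Hv v"
  by (intro topspace_Hv_top v_pos)

lemma const_in_Hv: "(\<lambda>_. c) \<in> Hv v"
  by (rule Hv_normI(1)[where B = "norm c"])
    (auto intro!: mult_left_le_one_le v_le_1 less_imp_le[OF v_pos])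

lemma Hv_norm_nonneg:
  assumes "f \<in> Hv v" shows "0 \<le> Hv_norm v f"
proof -
  have "0 \<le> v (norm (0::complex)) * norm (f 0)" using v_pos[of 0] by simp
  also have "\<dots> \<le> Hv_norm v f" by (rule Hv_norm_upper[OF assms])
  finally show ?thesis .
qed

lemma norm_le_of_Hv:
  assumes "f \<in> Hv v" shows "norm (f z) \<le> Hv_norm v f * exp (\<alpha> * norm z powr p)"
  using Hv_norm_upper[OF assms, of z] by (simp add: v exp_minus field_simps)

text \<open>The case \<open>s = 0\<close> of subordination bounds \<open>\<bar>\<mu> g\<bar>\<close> by \<open>\<alpha> r\<^sup>p\<close> up to a constant.\<close>

lemma exp_in_Hv:
  assumes "subordinate (norm \<mu>) g \<alpha> p"
  shows "(\<lambda>z. exp (\<mu> * poly g z)) \<in> Hv v"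
proof -
  let ?G = "poly (majorant g)"
  obtain K where K: "\<And>s r. 0 \<le> s \<Longrightarrow> s \<le> r \<Longrightarrow>
      norm \<mu> * (?G r - ?G s) \<le> K + \<alpha> * (r powr p - s powr p)"
    using subordinateE[OF assms] by blast
  show ?thesis
  proof (rule Hv_normI(1)[where B = "exp (K + norm \<mu> * ?G 0)"])
    fix z :: complex
    have "Re (\<mu> * poly g z) \<le> norm \<mu> * ?G (norm z)"
      by (rule order_trans[OF complex_Re_le_cmod]) (auto simp: norm_mult intro!: mult_left_mono norm_poly_le_majorant)
    also have "\<dots> \<le> K + \<alpha> * norm z powr p + norm \<mu> * ?G 0"
      using K[of 0 "norm z"] p by (simp add: algebra_simps)
    finally show "v (norm z) * norm (exp (\<mu> * poly g z)) \<le> exp (K + norm \<mu> * ?G 0)"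
      by (simp add: v norm_exp_eq_Re flip: exp_add)
  qed (intro holomorphic_intros)
qed

text \<open>The margin \<open>c = \<kappa> - \<bar>\<mu>\<bar>\<close> absorbs the growth of the factor \<open>g'\<close>: the product
\<open>G' exp (c G)\<close> is the derivative of \<open>exp (c G) / c\<close>. This is why subordination is needed at some \<open>\<kappa>\<close> strictly above
\<open>\<bar>\<mu>\<bar>\<close>.\<close>

lemma weighted_volterra_bounded:
  assumes sub: "subordinate \<kappa> g \<alpha> p" and \<mu>: "norm \<mu> < \<kappa>"
  obtains C where "\<And>h. h \<in> Hv v \<Longrightarrow> weighted_volterra g \<mu> h \<in> Hv v"
    "\<And>h. h \<in> Hv v \<Longrightarrow> Hv_norm v (weighted_volterra g \<mu> h) \<le> C * Hv_norm v h"
proof -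
  let ?G = "poly (majorant g)"
  obtain K where K: "\<And>s r. 0 \<le> s \<Longrightarrow> s \<le> r \<Longrightarrow>
      \<kappa> * (?G r - ?G s) \<le> K + \<alpha> * (r powr p - s powr p)"
    using subordinateE[OF sub] by blast
  define c where "c = \<kappa> - norm \<mu>"
  have c: "c > 0" using \<mu> by (simp add: c_def)
  have est: "v (norm z) * norm (weighted_volterra g \<mu> h z) \<le> exp K / c * Hv_norm v h"
    if h: "h \<in> Hv v" for h z
  proof -
    define r e where "r = norm z" and "e = sgn z"
    have r: "0 \<le> r" and e: "norm e \<le> 1" and z: "z = of_real r * e"
      by (auto simp: r_def e_def norm_sgn) (simp add: sgn_eq)
    define N where "N = Hv_norm v h"
    have N: "0 \<le> N" using h by (simp add: N_def Hv_norm_nonneg)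
    \<comment> \<open>\<open>F\<close> is the weighted quantity to be estimated, with the weight and the exponential frozen at the
      end point \<open>z\<close>, so that only the integral varies along the ray; \<open>\<phi>'\<close> bounds its derivative.\<close>
    define \<phi> where "\<phi> t = N * exp K / c * exp (- c * (?G r - ?G t))" for t
    define \<phi>' where "\<phi>' t = N * exp K * exp (- c * (?G r - ?G t)) * poly (pderiv (majorant g)) t" for t
    define F where "F w = of_real (v r) * exp (\<mu> * poly g z) *
        volterra (poly g) (\<lambda>\<zeta>. exp (- \<mu> * poly g \<zeta>) * h \<zeta>) w" for w
    define F' where "F' w = of_real (v r) * exp (\<mu> * poly g z) *
        (exp (- \<mu> * poly g w) * h w * poly (pderiv g) w)" for w
    have "norm (F (of_real r * e) - F (of_real 0 * e)) \<le> \<phi> r - \<phi> 0"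
    proof (rule norm_diff_along_ray_le[OF _ _ e r])
      have "h holomorphic_on UNIV" using h by (simp add: Hv_def)
      then have "(\<lambda>\<zeta>. exp (- \<mu> * poly g \<zeta>) * h \<zeta>) holomorphic_on UNIV"
        by (intro holomorphic_intros)
      then show "(F has_field_derivative F' w) (at w)" for w
        unfolding F_def[abs_def] F'_def by (intro DERIV_cmult volterra_has_field_derivative)
      show "(\<phi> has_real_derivative \<phi>' t) (at t)" for t
        unfolding \<phi>_def[abs_def] \<phi>'_def using c
        by (auto intro!: derivative_eq_intros simp: field_simps)
      fix t assume t: "0 \<le> t" "t \<le> r"
      let ?w = "of_real t * e"
      have w: "norm ?w \<le> t" using t e by (simp add: norm_mult mult_left_le)
      have "Re (\<mu> * (poly g z - poly g ?w)) \<le> norm \<mu> * (?G r - ?G t)"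
        by (rule order_trans[OF complex_Re_le_cmod], simp only: norm_mult z)
          (intro mult_left_mono poly_diff_along_ray_le e t norm_ge_zero)
      also have "\<dots> \<le> K + \<alpha> * (r powr p - t powr p) - c * (?G r - ?G t)"
        using K[OF t] by (simp add: c_def algebra_simps)
      finally have ex: "Re (\<mu> * (poly g z - poly g ?w))
          \<le> K + \<alpha> * (r powr p - t powr p) - c * (?G r - ?G t)" .
      have "norm (h ?w) \<le> N * exp (\<alpha> * norm ?w powr p)"
        unfolding N_def by (rule norm_le_of_Hv[OF h])
      also have "\<dots> \<le> N * exp (\<alpha> * t powr p)"
        using N w \<alpha> p by (intro mult_left_mono iffD2[OF exp_le_cancel_iff] powr_mono2) auto
      finally have hw: "norm (h ?w) \<le> N * exp (\<alpha> * t powr p)" .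
      have "norm (F' ?w) = v r * exp (Re (\<mu> * (poly g z - poly g ?w))) *
          norm (h ?w) * norm (poly (pderiv g) ?w)"
      proof -
        have "F' ?w = of_real (v r) * exp (\<mu> * (poly g z - poly g ?w)) * h ?w * poly (pderiv g) ?w"
          by (simp add: F'_def exp_diff exp_minus right_diff_distrib divide_inverse mult_ac)
        then show ?thesis using v_pos[OF r] by (simp only: norm_mult norm_exp_eq_Re) simp
      qed
      also have "\<dots> \<le> exp (- \<alpha> * r powr p) *
          exp (K + \<alpha> * (r powr p - t powr p) - c * (?G r - ?G t)) *
          (N * exp (\<alpha> * t powr p)) * poly (pderiv (majorant g)) t"
        unfolding pderiv_majorant v[OF r] using w ex N
        by (intro mult_mono hw norm_poly_le_majorant) auto
      also have "\<dots> = \<phi>' t"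
        by (simp add: \<phi>'_def exp_add exp_diff exp_minus right_diff_distrib field_simps)
      finally show "norm (F' ?w) \<le> \<phi>' t" .
    qed
    moreover have "F (of_real 0 * e) = 0" by (simp add: F_def)
    moreover have "norm (F (of_real r * e)) = v (norm z) * norm (weighted_volterra g \<mu> h z)"
      using v_pos[OF r] by (simp add: F_def weighted_volterra_def norm_mult flip: z r_def)
    moreover have "\<phi> r - \<phi> 0 \<le> exp K / c * N"
      using N c by (simp add: \<phi>_def mult.commute)
    ultimately show ?thesis by (simp add: N_def)
  qed
  show ?thesis
  proof (rule that)
    fix h assume h: "h \<in> Hv v"
    then have "weighted_volterra g \<mu> h holomorphic_on UNIV"
      by (intro weighted_volterra_holomorphic) (simp add: Hv_def)
    from Hv_normI[OF this est[OF h]]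
    show "weighted_volterra g \<mu> h \<in> Hv v"
      "Hv_norm v (weighted_volterra g \<mu> h) \<le> exp K / c * Hv_norm v h" .
  qed
qed

section \<open>The resolvent set and the spectrum\<close>

text \<open>Subordination at one \<open>\<kappa> > 1 / \<bar>l\<bar>\<close> bounds both the Volterra operator (\<open>\<mu> = 0\<close>), which keeps
\<open>V\<^sub>g - l\<close> inside the space, and the explicit inverse (\<open>\<mu> = 1 / l\<close>).\<close>

lemma in_resolvent_set:
  assumes sub: "subordinate \<kappa> g \<alpha> p" and l: "l \<noteq> 0" "1 / norm l < \<kappa>"
  shows "l \<in> resolvent_set (Hv_top v) (volterra (poly g))"
proof -
  let ?T = "\<lambda>f z. volterra (poly g) f z - l * f z" and ?R = "resolvent_op g l"
  have hol: "f holomorphic_on UNIV" if "f \<in> Hv v" for f using that by (simp add: Hv_def)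
  have "0 < 1 / norm l" using l(1) by simp
  with l(2) have \<kappa>: "norm (0::complex) < \<kappa>" by (simp only: norm_zero)
  obtain C0 where C0: "\<And>f. f \<in> Hv v \<Longrightarrow> volterra (poly g) f \<in> Hv v"
    using weighted_volterra_bounded[OF sub \<kappa>, folded volterra_eq_weighted] by metis
  have "norm (1 / l) < \<kappa>" using l by (simp add: norm_divide)
  from weighted_volterra_bounded[OF sub this] obtain C where
    C: "\<And>h. h \<in> Hv v \<Longrightarrow> weighted_volterra g (1 / l) h \<in> Hv v"
       "\<And>h. h \<in> Hv v \<Longrightarrow> Hv_norm v (weighted_volterra g (1 / l) h) \<le> C * Hv_norm v h" by metis
  have R_est: "v (norm z) * norm (?R h z) \<le> (1 / norm l + C / (norm l)\<^sup>2) * Hv_norm v h"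
    if h: "h \<in> Hv v" for h z
  proof -
    have "norm (?R h z) \<le> norm (h z) / norm l + norm (weighted_volterra g (1 / l) h z) / (norm l)\<^sup>2"
      unfolding resolvent_op_def
      by (rule order_trans[OF norm_triangle_ineq4]) (simp add: norm_divide norm_power)
    then have "v (norm z) * norm (?R h z) \<le> v (norm z) *
        (norm (h z) / norm l + norm (weighted_volterra g (1 / l) h z) / (norm l)\<^sup>2)"
      using v_pos[of "norm z"] by (intro mult_left_mono) auto
    also have "\<dots> = (v (norm z) * norm (h z)) / norm l
        + (v (norm z) * norm (weighted_volterra g (1 / l) h z)) / (norm l)\<^sup>2"
      by (simp add: distrib_left)
    also have "\<dots> \<le> Hv_norm v h / norm l + (C * Hv_norm v h) / (norm l)\<^sup>2"
      using Hv_norm_upper[OF h, of z] order_trans[OF Hv_norm_upper[OF C(1)[OF h], of z] C(2)[OF h]]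
      by (intro add_mono divide_right_mono) auto
    finally show ?thesis by (simp add: algebra_simps)
  qed
  have R_hol: "?R h holomorphic_on UNIV" if "h \<in> Hv v" for h
    unfolding resolvent_op_def[abs_def] using l hol[OF that]
    by (intro holomorphic_intros weighted_volterra_holomorphic) auto
  note R = Hv_normI[OF R_hol R_est]
  have T: "?T f \<in> Hv v" if f: "f \<in> Hv v" for f
  proof -
    have lf: "(\<lambda>z. l * f z) \<in> Hv v"
    proof (rule Hv_normI(1))
      show "(\<lambda>z. l * f z) holomorphic_on UNIV" using hol[OF f] by (intro holomorphic_intros)
      show "v (norm z) * norm (l * f z) \<le> norm l * Hv_norm v f" for z
        using mult_left_mono[OF Hv_norm_upper[OF f, of z], of "norm l"] by (simp add: norm_mult mult_ac)
    qed
    show ?thesis by (intro Hv_diff v_pos C0 f lf)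
  qed
  have bij: "bij_betw ?T (Hv v) (Hv v)"
    by (rule bij_betw_byWitness[where f' = ?R])
      (auto simp: resolvent_op_volterra volterra_resolvent_op hol l(1) intro!: T R(1))
  have inv: "inv_into (Hv v) ?T h = ?R h" if "h \<in> Hv v" for h
    using bij that by (intro inv_into_f_eq) (auto simp: bij_betw_def volterra_resolvent_op hol l(1) R(1))
  have "continuous_map (Hv_top v) (Hv_top v) ?R"
  proof (rule continuous_map_Hv_top[OF v_pos R(1) _ R(2)])
    show "?R (\<lambda>z. f z - h z) = (\<lambda>z. ?R f z - ?R h z)" if "f \<in> Hv v" "h \<in> Hv v" for f h
      by (simp add: resolvent_op_def fun_eq_iff weighted_volterra_diff[OF hol[OF that(1)] hol[OF that(2)]]
        diff_divide_distrib)
  qed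
  then have "continuous_map (Hv_top v) (Hv_top v) (inv_into (Hv v) ?T)"
    by (rule continuous_map_eq) (simp add: inv)
  with bij show ?thesis by (simp add: resolvent_set_def)
qed

lemma resolvent_set_surj:
  assumes "l \<in> resolvent_set (Hv_top v) T" "h \<in> Hv v"
  obtains f where "f \<in> Hv v" "\<And>z. T f z - l * f z = h z"
proof -
  have "h \<in> (\<lambda>f z. T f z - l * f z) ` Hv v"
    using assms by (simp add: resolvent_set_def bij_betw_def)
  then show ?thesis using that by (auto simp: fun_eq_iff)
qed

lemma zero_in_spectrum: "0 \<in> spectrum (Hv_top v) (volterra (poly g))"
proof -
  have "0 \<notin> resolvent_set (Hv_top v) (volterra (poly g))"
  proof
    assume "0 \<in> resolvent_set (Hv_top v) (volterra (poly g))"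
    from resolvent_set_surj[OF this const_in_Hv[of 1]] obtain f where
      "\<And>z. volterra (poly g) f z - 0 * f z = 1" by blast
    from this[of 0] show False by simp
  qed
  then show ?thesis by (simp add: spectrum_def)
qed

text \<open>As \<open>(e\<^sup>g\<^sup>/\<^sup>l)' = e\<^sup>g\<^sup>/\<^sup>l g' / l\<close> and \<open>g(0) = 0\<close>, the exponential is the only entire solution of
\<open>V\<^sub>g f - l f = - l\<close>; the constant \<open>- l\<close> is in the space, so surjectivity would put the exponential
there too.\<close>

lemma exp_notin_Hv_imp_spectrum:
  assumes g0: "poly g 0 = 0" and l: "l \<noteq> 0" and notin: "(\<lambda>z. exp (poly g z / l)) \<notin> Hv v"
  shows "l \<in> spectrum (Hv_top v) (volterra (poly g))"
proof -
  have "l \<notin> resolvent_set (Hv_top v) (volterra (poly g))"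
  proof
    assume "l \<in> resolvent_set (Hv_top v) (volterra (poly g))"
    from resolvent_set_surj[OF this const_in_Hv[of "- l"]] obtain f where
      f: "f \<in> Hv v" "\<And>z. volterra (poly g) f z - l * f z = - l" by blast
    then have "f holomorphic_on UNIV" by (simp add: Hv_def)
    from resolvent_op_volterra[OF this l, of g] f(2)
    have "f = resolvent_op g l (\<lambda>_. - l)" by simp
    also have "weighted_volterra g (1 / l) (\<lambda>_. - l) = (\<lambda>z. l\<^sup>2 * (1 - exp (poly g z / l)))"
      by (rule weighted_volterra_eqI)
        (use l g0 in \<open>auto intro!: derivative_eq_intros simp: field_simps power2_eq_square\<close>)
    then have "resolvent_op g l (\<lambda>_. - l) = (\<lambda>z. exp (poly g z / l))"
      using l by (simp add: resolvent_op_def fun_eq_iff)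
    finally show False using f(1) notin by simp
  qed
  then show ?thesis by (simp add: spectrum_def)
qed

end


section \<open>The critical case, where the degree equals the exponent of the weight\<close>

lemma aligned_direction_exists:
  assumes "n > 0" "\<beta> \<noteq> 0" "l \<noteq> (0::complex)"
  obtains e where "norm e = 1" "\<beta> * e ^ n / l = of_real (norm \<beta> / norm l)"
proof -
  obtain e where e: "e ^ n = cnj (sgn (\<beta> / l))"
    using exists_complex_root[of n "cnj (sgn (\<beta> / l))"] assms(1) by (metis less_not_refl)
  have "norm e ^ n = 1"
    using arg_cong[OF e, of norm] assms by (simp add: norm_power norm_sgn norm_divide)
  then have "norm e = 1" using assms(1) power_eq_imp_eq_base[of "norm e" n 1] by simp
  moreover have "\<beta> * e ^ n / l = (\<beta> / l) * cnj (\<beta> / l) / of_real (norm (\<beta> / l))"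
    by (simp add: e sgn_eq)
  then have "\<beta> * e ^ n / l = of_real (norm \<beta> / norm l)"
    using assms by (simp add: norm_divide power2_eq_square flip: complex_norm_square)
  ultimately show ?thesis using that by blast
qed

text \<open>The critical radius \<open>\<bar>\<beta>\<bar> / \<alpha>\<close> involves only the top coefficient of \<open>g\<close>, but the membership of
\<open>e\<^sup>g\<^sup>/\<^sup>l\<close> on the critical circle depends on \<open>k\<close>; the decomposition keeps the two apart.\<close>

locale critical_symbol = exp_weight +
  fixes n :: nat and \<beta> :: complex and g k :: "complex poly"
  assumes p_eq: "p = real n" and g_eq: "g = monom \<beta> n + k" and deg_k: "degree k < n"
    and \<beta>: "\<beta> \<noteq> 0"
begin

lemma n_pos: "n > 0" using deg_k by simp

lemma v_eq: "r \<ge> 0 \<Longrightarrow> v r = exp (- \<alpha> * r ^ n)"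
  using n_pos by (simp add: v p_eq powr_realpow')

lemma poly_g: "poly g z = \<beta> * z ^ n + poly k z"
  by (simp add: g_eq poly_monom)

text \<open>On a ray along which \<open>\<beta> z\<^sup>n / l\<close> is positive, the exponent \<open>\<bar>\<beta>\<bar> / \<bar>l\<bar> r\<^sup>n\<close> beats \<open>\<alpha> r\<^sup>n\<close>, and the
lower order terms \<open>k\<close> cannot compensate.\<close>

lemma exp_notin_Hv:
  assumes l: "l \<noteq> 0" "norm l < norm \<beta> / \<alpha>"
  shows "(\<lambda>z. exp (poly g z / l)) \<notin> Hv v"
proof
  assume inHv: "(\<lambda>z. exp (poly g z / l)) \<in> Hv v"
  define B where "B = Hv_norm v (\<lambda>z. exp (poly g z / l))"
  obtain e where e: "norm e = 1" "\<beta> * e ^ n / l = of_real (norm \<beta> / norm l)"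
    using aligned_direction_exists[OF n_pos \<beta> l(1)] by metis
  have "0 < norm \<beta> - \<alpha> * norm l"
    using l(2) \<alpha> by (simp add: field_simps)
  from power_not_le_smaller_degree[OF deg_k this, of "norm l * B"] obtain r where
    r: "0 \<le> r" "norm l * B + poly (majorant k) r < (norm \<beta> - \<alpha> * norm l) * r ^ n" by blast
  let ?z = "of_real r * e"
  have nz: "norm ?z = r" using r e by (simp add: norm_mult)
  have "Re (poly g ?z / l) = norm \<beta> / norm l * r ^ n + Re (poly k ?z / l)"
  proof -
    have "poly g ?z / l = of_real (r ^ n) * (\<beta> * e ^ n / l) + poly k ?z / l"
      by (simp add: poly_g power_mult_distrib add_divide_distrib)
    also have "Re \<dots> = norm \<beta> / norm l * r ^ n + Re (poly k ?z / l)"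
      unfolding e(2) plus_complex.sel Re_complex_of_real of_real_mult[symmetric] by simp
    finally show ?thesis .
  qed
  moreover have "\<bar>Re (poly k ?z / l)\<bar> \<le> poly (majorant k) r / norm l"
    by (rule order_trans[OF abs_Re_le_cmod])
      (auto simp: norm_divide nz intro!: divide_right_mono norm_poly_le_majorant)
  moreover have "- \<alpha> * r ^ n + Re (poly g ?z / l) \<le> B"
  proof -
    have "exp (- \<alpha> * r ^ n + Re (poly g ?z / l)) \<le> B"
      using Hv_norm_upper[OF inHv, of ?z] unfolding nz v_eq[OF r(1)] norm_exp_eq_Re exp_add B_def .
    then show ?thesis using exp_ge_add_one_self[of "- \<alpha> * r ^ n + Re (poly g ?z / l)"] by linarith
  qed
  ultimately have "norm \<beta> / norm l * r ^ n - \<alpha> * r ^ n \<le> B + poly (majorant k) r / norm l" by linarith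
  then have "norm l * (norm \<beta> / norm l * r ^ n - \<alpha> * r ^ n) \<le> norm l * (B + poly (majorant k) r / norm l)"
    by (intro mult_left_mono) auto
  with r(2) l(1) show False by (simp add: algebra_simps)
qed

text \<open>Write a solution of \<open>V\<^sub>g f - l f = h\<close>, where \<open>h = exp (\<beta> z\<^sup>n / l)\<close>, as \<open>f = h u\<close>. Passing from \<open>f\<close>
to \<open>u\<close> removes the top order term from the differential equation, which becomes
\<open>(\<beta> z\<^sup>n / l + l u)' = k' u\<close>. On the aligned ray \<open>\<bar>h\<bar>\<close> is the reciprocal of the weight, so \<open>u\<close> is
bounded there when \<open>f\<close> is in the space. Integrating, \<open>\<alpha> r\<^sup>n\<close> would be bounded by a polynomial of
degree less than \<open>n\<close>.\<close>

lemma boundary_in_spectrum: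
  assumes l: "norm l = norm \<beta> / \<alpha>"
  shows "l \<in> spectrum (Hv_top v) (volterra (poly g))"
proof -
  have l0: "l \<noteq> 0" using l \<beta> \<alpha> by auto
  have \<alpha>_eq: "norm \<beta> / norm l = \<alpha>" using \<alpha> \<beta> by (simp add: l)
  have "l \<notin> resolvent_set (Hv_top v) (volterra (poly g))"
  proof
    assume res: "l \<in> resolvent_set (Hv_top v) (volterra (poly g))"
    define h where "h z = exp (\<beta> * z ^ n / l)" for z
    have "h \<in> Hv v"
    proof (rule Hv_normI(1)[where B = 1])
      show "h holomorphic_on UNIV" unfolding h_def[abs_def] using l0 by (intro holomorphic_intros) auto
      show "v (norm z) * norm (h z) \<le> 1" for z
      proof -
        have "Re (\<beta> * z ^ n / l) \<le> norm \<beta> / norm l * norm z ^ n"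
          by (rule order_trans[OF complex_Re_le_cmod]) (simp add: norm_mult norm_divide norm_power)
        then show ?thesis by (simp add: v_eq h_def \<alpha>_eq norm_exp_eq_Re flip: exp_add)
      qed
    qed
    from resolvent_set_surj[OF res this] obtain f where
      f: "f \<in> Hv v" and sol: "\<And>z. volterra (poly g) f z - l * f z = h z" by blast
    define N where "N = Hv_norm v f"
    have N: "0 \<le> N" using f by (simp add: N_def Hv_norm_nonneg)
    define u where "u z = f z * exp (- (\<beta> * z ^ n / l))" for z
    define F where "F z = \<beta> * z ^ n / l + l * u z" for z
    have f_hol: "f holomorphic_on UNIV" using f by (simp add: Hv_def)
    have f_eq: "f = (\<lambda>z. (volterra (poly g) f z - h z) / l)"
      using l0 sol by (auto simp: fun_eq_iff field_simps)
    have g': "poly (pderiv g) z = of_nat n * \<beta> * z ^ (n - 1) + poly (pderiv k) z" for z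
      by (simp add: g_eq pderiv_add pderiv_monom poly_monom)
    have f': "(f has_field_derivative
        (f z * poly (pderiv g) z - h z * (of_nat n * \<beta> * z ^ (n - 1) / l)) / l) (at z)" for z
      by (subst f_eq) (use l0 in \<open>auto simp: h_def intro!: derivative_eq_intros volterra_has_field_derivative f_hol\<close>)
    have F': "(F has_field_derivative u z * poly (pderiv k) z) (at z)" for z
      unfolding F_def[abs_def] u_def
      by (rule derivative_eq_intros f' refl | use l0 in \<open>simp; fail\<close>)+
        (use l0 in \<open>simp add: g' h_def field_simps exp_minus\<close>)
    obtain e where e: "norm e = 1" "\<beta> * e ^ n / l = of_real \<alpha>"
      using aligned_direction_exists[OF n_pos \<beta> l0] unfolding \<alpha>_eq by metis
    have ray: "\<beta> * (of_real r * e) ^ n / l = of_real (\<alpha> * r ^ n)" for r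
    proof -
      have "\<beta> * (of_real r * e) ^ n / l = of_real r ^ n * (\<beta> * e ^ n / l)"
        by (simp add: power_mult_distrib)
      then show ?thesis by (simp add: e(2))
    qed
    have u_le: "norm (u (of_real r * e)) \<le> N" if "0 \<le> r" for r
      using Hv_norm_upper[OF f, of "of_real r * e"] that e(1)
      by (simp only: u_def ray norm_mult) (simp add: N_def v_eq mult.commute norm_exp_eq_Re)
    \<comment> \<open>Dividing by \<open>N + 1\<close> instead of \<open>N\<close> covers \<open>N = 0\<close>.\<close>
    have "\<alpha> / (N + 1) > 0" using \<alpha> N by simp
    from power_not_le_smaller_degree[OF deg_k this, of "2 * norm l"] obtain r where
      r: "0 \<le> r" "2 * norm l + poly (majorant k) r < \<alpha> / (N + 1) * r ^ n" by blast
    have "norm (F (of_real r * e) - F (of_real 0 * e)) \<le> N * poly (majorant k) r - N * poly (majorant k) 0"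
    proof (rule norm_diff_along_ray_le[OF F' _ _ r(1)])
      show "((\<lambda>t. N * poly (majorant k) t) has_real_derivative N * poly (pderiv (majorant k)) t) (at t)" for t
        by (intro DERIV_cmult poly_DERIV)
      show "norm e \<le> 1" using e by simp
      show "norm (u (of_real t * e) * poly (pderiv k) (of_real t * e)) \<le> N * poly (pderiv (majorant k)) t"
        if "0 \<le> t" "t \<le> r" for t
        unfolding norm_mult pderiv_majorant using that N e(1)
        by (intro mult_mono u_le norm_poly_le_majorant) (auto simp: norm_mult)
    qed
    also have "\<dots> \<le> N * poly (majorant k) r" using N majorant_nonneg[of 0 k] by simp
    also have "F (of_real r * e) - F (of_real 0 * e) =
        of_real (\<alpha> * r ^ n) + (l * u (of_real r * e) - l * u (of_real 0 * e))"
      unfolding F_def ray using n_pos by simp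
    finally have "norm (of_real (\<alpha> * r ^ n) + (l * u (of_real r * e) - l * u (of_real 0 * e)))
      \<le> N * poly (majorant k) r" .
    moreover have "norm (l * u (of_real r * e) - l * u (of_real 0 * e)) \<le> norm l * N + norm l * N"
      by (rule order_trans[OF norm_triangle_ineq4])
        (simp only: norm_mult, intro add_mono mult_left_mono u_le r norm_ge_zero order_refl)
    moreover have "norm (of_real (\<alpha> * r ^ n) :: complex) = \<alpha> * r ^ n"
      using \<alpha> r(1) by (simp del: of_real_mult of_real_power)
    ultimately have "\<alpha> * r ^ n \<le> N * (2 * norm l + poly (majorant k) r)"
      using norm_diff_ineq[of "of_real (\<alpha> * r ^ n) :: complex"
        "l * u (of_real r * e) - l * u (of_real 0 * e)"] by (simp add: algebra_simps)
    also have "\<dots> \<le> (N + 1) * (2 * norm l + poly (majorant k) r)"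
      using majorant_nonneg[OF r(1), of k] by (intro mult_right_mono) auto
    finally show False using r(2) N by (simp add: field_simps)
  qed
  then show ?thesis by (simp add: spectrum_def)
qed

lemma subordinate_critical:
  fixes l :: complex
  assumes "norm \<beta> / \<alpha> < norm l"
  obtains \<kappa> where "subordinate \<kappa> g \<alpha> p" "1 / norm l < \<kappa>"
proof -
  have l: "0 < norm l" using assms \<alpha> by (smt (verit) divide_nonneg_pos norm_ge_zero)
  have deg: "degree g = n" and lead: "lead_coeff g = \<beta>"
  proof -
    have "degree k < degree (monom \<beta> n)" using \<beta> deg_k by (simp add: degree_monom_eq)
    then show "degree g = n" unfolding g_eq using \<beta> by (simp add: degree_add_eq_left degree_monom_eq)
    with deg_k show "lead_coeff g = \<beta>" by (simp add: g_eq coeff_eq_0)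
  qed
  have "1 / norm l < \<alpha> / norm \<beta>" using assms l \<alpha> \<beta> by (simp add: field_simps)
  then obtain \<kappa> where \<kappa>: "1 / norm l < \<kappa>" "\<kappa> < \<alpha> / norm \<beta>" using dense by blast
  have "0 \<le> \<kappa>" using \<kappa>(1) l by (smt (verit) divide_nonneg_pos)
  moreover have "\<kappa> * norm \<beta> < \<alpha>" using \<kappa>(2) \<beta> by (simp add: field_simps)
  ultimately have "subordinate \<kappa> g \<alpha> p"
    by (intro subordinateI) (use deg lead p_eq p \<alpha> in auto)
  with \<kappa>(1) that show ?thesis by blast
qed

text \<open>The set contains the open punctured disc and lies in the closed disc; what happens on the circle
itself does not affect the closure.\<close>

lemma closure_exp_notin_Hv:
  "{0} \<union> closure {l. l \<noteq> 0 \<and> (\<lambda>z. exp (poly g z / l)) \<notin> Hv v} = cball 0 (norm \<beta> / \<alpha>)"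
  (is "{0} \<union> closure ?E = _")
proof (rule antisym)
  have pos: "0 < norm \<beta> / \<alpha>" using \<alpha> \<beta> by simp
  have "(\<lambda>z. exp (poly g z / l)) \<in> Hv v" if gt: "norm \<beta> / \<alpha> < norm l" for l :: complex
  proof -
    obtain \<kappa> where "subordinate \<kappa> g \<alpha> p" "1 / norm l < \<kappa>" using subordinate_critical[OF gt] by blast
    then have "subordinate (norm (1 / l)) g \<alpha> p"
      by (elim subordinate_mono) (simp add: norm_divide)
    from exp_in_Hv[OF this] show ?thesis by simp
  qed
  then have "?E \<subseteq> cball 0 (norm \<beta> / \<alpha>)" by force
  then have "closure ?E \<subseteq> cball 0 (norm \<beta> / \<alpha>)" by (intro closure_minimal) auto
  with pos show "{0} \<union> closure ?E \<subseteq> cball 0 (norm \<beta> / \<alpha>)" by auto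
  have "ball (0 :: complex) (norm \<beta> / \<alpha>) \<subseteq> {0} \<union> ?E" using exp_notin_Hv by auto
  then have "closure (ball 0 (norm \<beta> / \<alpha>)) \<subseteq> closure ({0} \<union> ?E)" by (rule closure_mono)
  then show "cball 0 (norm \<beta> / \<alpha>) \<subseteq> {0} \<union> closure ?E"
    unfolding closure_Un closure_ball[OF pos] by simp
qed

lemma spectrum_critical:
  assumes "poly g 0 = 0"
  shows "spectrum (Hv_top v) (volterra (poly g)) = cball 0 (norm \<beta> / \<alpha>)"
proof (rule antisym)
  show "spectrum (Hv_top v) (volterra (poly g)) \<subseteq> cball 0 (norm \<beta> / \<alpha>)"
  proof
    fix l assume l: "l \<in> spectrum (Hv_top v) (volterra (poly g))"
    show "l \<in> cball 0 (norm \<beta> / \<alpha>)"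
    proof (rule ccontr)
      assume "l \<notin> cball 0 (norm \<beta> / \<alpha>)"
      then have gt: "norm \<beta> / \<alpha> < norm l" by simp
      moreover have "0 < norm \<beta> / \<alpha>" using \<alpha> \<beta> by simp
      ultimately have "l \<noteq> 0" by auto
      moreover obtain \<kappa> where "subordinate \<kappa> g \<alpha> p" "1 / norm l < \<kappa>"
        using subordinate_critical[OF gt] by blast
      ultimately show False using in_resolvent_set l by (auto simp: spectrum_def)
    qed
  qed
  show "cball 0 (norm \<beta> / \<alpha>) \<subseteq> spectrum (Hv_top v) (volterra (poly g))"
  proof
    fix l :: complex assume "l \<in> cball 0 (norm \<beta> / \<alpha>)"
    then consider "l = 0" | "l \<noteq> 0" "norm l < norm \<beta> / \<alpha>" | "norm l = norm \<beta> / \<alpha>" by force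
    then show "l \<in> spectrum (Hv_top v) (volterra (poly g))"
      using zero_in_spectrum exp_notin_Hv_imp_spectrum[OF assms _ exp_notin_Hv] boundary_in_spectrum
      by cases auto
  qed
qed

end

lemma (in exp_weight) spectrum_subcritical:
  assumes "real (degree g) < p"
  shows "spectrum (Hv_top v) (volterra (poly g)) = {0}"
    and "{l. l \<noteq> 0 \<and> (\<lambda>z. exp (poly g z / l)) \<notin> Hv v} = {}"
proof -
  have sub: "subordinate \<kappa> g \<alpha> p" if "0 \<le> \<kappa>" for \<kappa>
    using assms that p \<alpha> by (intro subordinateI) auto
  have "l \<in> resolvent_set (Hv_top v) (volterra (poly g))" if "l \<noteq> 0" for l
    by (rule in_resolvent_set[OF sub[of "1 / norm l + 1"] that]) auto
  then show "spectrum (Hv_top v) (volterra (poly g)) = {0}"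
    using zero_in_spectrum by (auto simp: spectrum_def)
  have "(\<lambda>z. exp (poly g z / l)) \<in> Hv v" for l
    using exp_in_Hv[OF sub[of "norm (1 / l)"]] by simp
  then show "{l. l \<noteq> 0 \<and> (\<lambda>z. exp (poly g z / l)) \<notin> Hv v} = {}" by simp
qed

section \<open>Determination of the spectrum\<close>

theorem theorem2p3:
  fixes \<alpha> p :: real and v :: "real \<Rightarrow> real" and g :: "complex poly" and n :: nat
  assumes "\<alpha> > 0" and "p > 0"
    and "\<And>r. r \<ge> 0 \<Longrightarrow> v r = exp (- \<alpha> * r powr p)"
    and "degree g = n" and "int n \<le> \<lfloor>p\<rfloor>" and "poly g 0 = 0"
  shows "(real n < p \<longrightarrow> spectrum (Hv_top v) (volterra (poly g)) = {0}) \<and>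
    (\<forall>\<beta> k. p = real n \<and> g = monom \<beta> n + k \<and> degree k < n \<longrightarrow>
       spectrum (Hv_top v) (volterra (poly g)) = {l. norm l \<le> norm \<beta> / \<alpha>}) \<and>
    spectrum (Hv_top v) (volterra (poly g)) =
      {0} \<union> closure {l. l \<noteq> 0 \<and> (\<lambda>z. exp (poly g z / l)) \<notin> Hv v}"
proof -
  interpret exp_weight \<alpha> p v by unfold_locales (use assms in auto)
  have "real n \<le> p" using assms(5) by (simp add: le_floor_iff)
  then consider "real n < p" | "p = real n" by linarith
  then show ?thesis
  proof cases
    case 1
    with assms(4) have deg: "real (degree g) < p" by simp
    from 1 show ?thesis unfolding spectrum_subcritical[OF deg] by simp
  next
    case 2
    with assms(2) have n: "n > 0" by simp
    have critical: "critical_symbol \<alpha> p v n \<beta> g k" if "g = monom \<beta> n + k" "degree k < n" for \<beta> k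
    proof unfold_locales
      have "lead_coeff g = \<beta>" using assms(4) that by (simp add: coeff_eq_0)
      moreover have "g \<noteq> 0" using assms(4) n by auto
      ultimately show "\<beta> \<noteq> 0" by auto
    qed (use 2 that in auto)
    define k where "k = g - monom (lead_coeff g) n"
    have "degree k < n"
    proof (rule degree_lessI)
      show "\<forall>j\<ge>n. coeff k j = 0"
        using assms(4) by (auto simp: k_def coeff_eq_0)
    qed (use n in simp)
    then have c: "critical_symbol \<alpha> p v n (lead_coeff g) g k" by (intro critical) (auto simp: k_def)
    have "spectrum (Hv_top v) (volterra (poly g)) =
      {0} \<union> closure {l. l \<noteq> 0 \<and> (\<lambda>z. exp (poly g z / l)) \<notin> Hv v}"
      using critical_symbol.closure_exp_notin_Hv[OF c] critical_symbol.spectrum_critical[OF c assms(6)] by simp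
    moreover have "spectrum (Hv_top v) (volterra (poly g)) = {l. norm l \<le> norm \<beta> / \<alpha>}"
      if "g = monom \<beta> n + k" "degree k < n" for \<beta> k
      using critical_symbol.spectrum_critical[OF critical[OF that] assms(6)] by (auto simp: cball_def)
    ultimately show ?thesis using 2 by auto
  qed
qed

end
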